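(* Let $c_0>0$ be a universal constant with the following property (such a constant exists): for every compact connected metric space $Z\subseteq\ell^\infty$, if $\beta'_Z(x,r)>\beta>0$ for all $x\in Z$ and all $r\in(0,r_0)$ for some $r_0>0$, then $\dim Z\ge 1+c_0\beta^2$. Let $X$ be a compact connected metric space in $\ell^\infty$. (1) If $B_X(x,r)$ has a $c$-antenna, then $\beta'_X(x,r)>\frac{c}{7}$. Hence, if $X$ is $c$-antenna-like, then $\dim X\ge 1+\frac{c_0}{49}c^2$. (2) Any quasisymmetric image of an antenna-like set into any metric space is also antenna-like and hence has Hausdorff dimension strictly larger than one.
   Context: $\dim$ denotes Hausdorff dimension. Write $|\cdot|$ for the norm of $\ell^\infty$, $B(x,r)=\{y\in\ell^\infty:|x-y|<r\}$, and, for a metric space $(X,d)$, $B_X(x,r)=\{y\in X: d(x,y)<r\}$. For $X\subseteq\ell^\infty$, $x\in X$, $r>0$ define $$\beta'_X(x,r)=\inf_s\frac{\ell(s)-|s(0)-s(1)|+\sup_{z\in X\cap B(x,r)}\mathrm{dist}(z,s([0,1]))}{|s(0)-s(1)|},$$ where the infimum is over all curves $s:[0,1]\to B(x,r)\subseteq\ell^\infty$, and $\ell(s)$ is the length of $s$ (the supremum of $\sum_{i=0}^{n-1}|s(t_i)-s(t_{i+1})|$ over all partitions $0=t_0<t_1<\dots<t_n=1$). Antennas: let $c>0$ and $Y=[0,e_1]\cup[0,e_2]\cup[0,e_3]\subseteq\mathbb{R}^3$, where $e_j$ is the $j$th standard basis vector and $[0,e_j]$ is the segment from $0$ to $e_j$.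 For a compact connected metric space $X$, $x\in X$ and $r>0$, the ball $B_X(x,r)$ has a $c$-antenna if there is a homeomorphism $h:Y\to h(Y)\subseteq B_X(x,r)$ such that the distance between $h(e_i)$ and $h([0,e_j]\cup[0,e_k])$ is at least $cr$ for all permutations $(i,j,k)$ of $(1,2,3)$. $X$ is $c$-antenna-like if $B_X(x,r)$ has a $c$-antenna for every $x\in X$ and every $0<r<\frac{\mathrm{diam}\,X}{2}$; it is antenna-like if it is $c$-antenna-like for some $c>0$. A map $f:X\to W$ between two metric spaces is quasisymmetric if there is an increasing homeomorphism $\eta:(0,\infty)\to(0,\infty)$ such that for any distinct $x,y,z\in X$, $\frac{|f(x)-f(y)|}{|f(z)-f(y)|}\le\eta\left(\frac{|x-y|}{|z-y|}\right)$, where $|a-b|$ denotes the distance between $a$ and $b$ in the relevant space.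
   Formalization: The two dimension conclusions are stated for sets of positive diameter, since a one-point space is vacuously c-antenna-like but has dimension 0; quasisymmetric maps are taken injective so that the quotients are defined. *)

theory Defs
  imports "HOL-Analysis.Analysis"
begin

(* The topology of nat is discrete, so every function on nat is continuous and
   this is the space of all bounded real sequences with the supremum norm. *)
type_synonym linfty = "nat \<Rightarrow>\<^sub>C real"

(* Boundedness of the covering sets is required because diameter is unspecified
   on unbounded sets. *)
definition hausdorff_premeasure :: "real \<Rightarrow> real \<Rightarrow> 'a::metric_space set \<Rightarrow> ennreal" where
  "hausdorff_premeasure \<delta> s A =
     (INF U\<in>{U :: nat \<Rightarrow> 'a set. A \<subseteq> (\<Union>i. U i) \<and> (\<forall>i. bounded (U i) \<and> diameter (U i) \<le> \<delta>)}.
        \<Sum>i. ennreal (diameter (U i) powr s))"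

(* Only meaningful for s > 0: since 0 powr 0 = 0, the case s = 0 is not counting measure. *)
definition hausdorff_measure :: "real \<Rightarrow> 'a::metric_space set \<Rightarrow> ennreal" where
  "hausdorff_measure s A = (SUP \<delta>\<in>{0<..}. hausdorff_premeasure \<delta> s A)"

(* The infimum of the empty set is infinity, so sets of infinite dimension are covered. *)
definition hausdorff_dim :: "'a::metric_space set \<Rightarrow> ereal" where
  "hausdorff_dim A = Inf (ereal ` {s. 0 < s \<and> hausdorff_measure s A = 0})"

definition curve_length :: "(real \<Rightarrow> 'a::metric_space) \<Rightarrow> ereal" where
  "curve_length s =
     (SUP (n, t)\<in>{(n::nat, t::nat \<Rightarrow> real).
                    0 < n \<and> t 0 = 0 \<and> t n = 1 \<and> (\<forall>i<n. t i < t (Suc i))}.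
        ereal (\<Sum>i<n. dist (s (t i)) (s (t (Suc i)))))"

(* Curves of infinite length contribute the value infinity.  Curves with equal endpoints,
   whose quotient has denominator 0, are excluded: division by zero yields 0 here. *)
definition beta' :: "linfty set \<Rightarrow> linfty \<Rightarrow> real \<Rightarrow> ereal" where
  "beta' X x r =
     (INF s\<in>{s. path s \<and> path_image s \<subseteq> ball x r \<and> s 0 \<noteq> s 1}.
        (curve_length s - ereal (dist (s 0) (s 1))
           + (SUP z\<in>X \<inter> ball x r. ereal (infdist z (path_image s))))
        / ereal (dist (s 0) (s 1)))"

definition arm :: "3 \<Rightarrow> (real^3) set" where
  "arm j = closed_segment 0 (axis j 1)"

definition tripod :: "(real^3) set" where
  "tripod = arm 1 \<union> arm 2 \<union> arm 3"

definition has_antenna :: "real \<Rightarrow> 'a::metric_space set \<Rightarrow> 'a \<Rightarrow> real \<Rightarrow> bool" where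
  "has_antenna c X x r \<longleftrightarrow>
     (\<exists>h h'. homeomorphism tripod (h ` tripod) h h' \<and> h ` tripod \<subseteq> X \<inter> ball x r \<and>
        (\<forall>i j k :: 3. i \<noteq> j \<and> j \<noteq> k \<and> i \<noteq> k \<longrightarrow>
           c * r \<le> infdist (h (axis i 1)) (h ` (arm j \<union> arm k))))"

definition antenna_like_with :: "real \<Rightarrow> 'a::metric_space set \<Rightarrow> bool" where
  "antenna_like_with c X \<longleftrightarrow> compact X \<and> connected X \<and>
     (\<forall>x\<in>X. \<forall>r. 0 < r \<and> r < diameter X / 2 \<longrightarrow> has_antenna c X x r)"

definition antenna_like :: "'a::metric_space set \<Rightarrow> bool" where
  "antenna_like X \<longleftrightarrow> (\<exists>c>0. antenna_like_with c X)"

(* Injectivity makes the quotient of image distances well defined; without it,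
   division by zero would make constant maps quasisymmetric. *)
definition quasisymmetric_on ::
    "'a::metric_space set \<Rightarrow> ('a \<Rightarrow> 'b::metric_space) \<Rightarrow> bool" where
  "quasisymmetric_on X f \<longleftrightarrow> inj_on f X \<and>
     (\<exists>\<eta> \<eta>' :: real \<Rightarrow> real. homeomorphism {0<..} {0<..} \<eta> \<eta>' \<and> strict_mono_on {0<..} \<eta> \<and>
        (\<forall>x\<in>X. \<forall>y\<in>X. \<forall>z\<in>X. x \<noteq> y \<and> y \<noteq> z \<and> x \<noteq> z \<longrightarrow>
           dist (f x) (f y) / dist (f z) (f y) \<le> \<eta> (dist x y / dist z y)))"

end

theory Submission
  imports Defs
begin

(* (1) Project the three tips of an antenna to a competing curve s and let the middle one have
   parameter m. The parts of X near s[0,m] and near s[m,1] overlap on the arms leading to the two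
   outer tips, since these arms are connected. A point w of the overlap is close to s(u) and s(v)
   with u <= m <= v, so s(u), s(v) are close to each other; as the excess length of s is small,
   w is then also close to s(m), hence to the middle tip.
   (2) A quasisymmetric map of a compact set is a homeomorphism onto its image. An
   antenna for the image ball around f(x) of radius rho is the image of an antenna for the ball
   around x whose radius is a third of the distance from x to the nearest point z with
   |f(x) - f(z)| >= rho: the arms are then separated on a scale comparable to their distance
   from z, and the image of z is far from f(x). For the dimension bound the image is
   embedded isometrically into the bounded sequences (Frechet--Kuratowski). *)

section \<open>Antennas and the flatness coefficient\<close>

lemma sum_dist_le_curve_length_strict:
  assumes "0 < n" "t 0 = 0" "t n = 1" "\<And>i. i < n \<Longrightarrow> t i < t (Suc i)"
  shows "ereal (\<Sum>i<n. dist (s (t i)) (s (t (Suc i)))) \<le> curve_length s"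
  unfolding curve_length_def
  using assms by (intro SUP_upper2[of "(n, t)"]) auto

text \<open>Lists may repeat a point, whereas the partitions in \<open>curve_length\<close> are
  strictly increasing; this allows parameters that happen to coincide.\<close>

fun chain_length :: "'a::metric_space list \<Rightarrow> real" where
  "chain_length (x # y # xs) = dist x y + chain_length (y # xs)"
| "chain_length _ = 0"

lemma chain_length_eq_sum:
  "chain_length xs = (\<Sum>i<length xs - 1. dist (xs ! i) (xs ! Suc i))"
proof (induction xs rule: chain_length.induct)
  case (1 x y xs)
  then show ?case by (simp add: sum.lessThan_Suc_shift del: sum.lessThan_Suc)
qed auto

text \<open>Merging equal neighbouring parameters only drops terms
  \<open>dist (s x) (s x) = 0\<close>.\<close>

lemma chain_length_map_remdups_adj:
  "chain_length (map s (remdups_adj xs)) = chain_length (map s xs)"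
proof (induction xs rule: remdups_adj.induct)
  case (3 x y xs)
  show ?case
  proof (cases "x = y")
    case False
    obtain zs where "remdups_adj (y # xs) = y # zs"
      by (metis remdups_adj_Cons_alt)
    with 3 False show ?thesis by simp
  qed (use 3 in simp)
qed auto

lemma chain_length_le_curve_length:
  assumes "sorted xs" "xs \<noteq> []" "hd xs = 0" "last xs = 1"
  shows "ereal (chain_length (map s xs)) \<le> curve_length s"
proof -
  define ys where "ys = remdups_adj xs"
  have ne: "ys \<noteq> []" using assms by (simp add: ys_def)
  have hd: "hd ys = 0" and last: "last ys = 1"
    using assms by (simp_all add: ys_def)
  have len: "1 < length ys"
  proof (rule ccontr)
    assume "\<not> 1 < length ys"
    with ne obtain y where "ys = [y]" by (cases ys) auto
    with hd last show False by simp
  qed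
  have "ys ! i < ys ! Suc i" if "i < length ys - 1" for i
  proof -
    have "ys ! i \<le> ys ! Suc i"
      using that assms by (intro sorted_nth_mono) (auto simp: ys_def)
    moreover have "ys ! i \<noteq> ys ! Suc i"
      using that remdups_adj_adjacent[of i xs] by (auto simp: ys_def)
    ultimately show ?thesis by simp
  qed
  then have "ereal (\<Sum>i<length ys - 1. dist (s (ys ! i)) (s (ys ! Suc i))) \<le> curve_length s"
    using len hd last ne
    by (intro sum_dist_le_curve_length_strict) (auto simp: hd_conv_nth last_conv_nth)
  moreover have "chain_length (map s ys) = (\<Sum>i<length ys - 1. dist (s (ys ! i)) (s (ys ! Suc i)))"
    by (simp add: chain_length_eq_sum)
  ultimately show ?thesis
    by (simp add: ys_def chain_length_map_remdups_adj)
qed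

text \<open>The inequalities are weak on purpose: \<open>u = m = v = 0\<close> gives the bound of
  the length by the endpoint distance.\<close>

lemma four_chords_le_curve_length:
  assumes "0 \<le> u" "u \<le> m" "m \<le> v" "v \<le> 1"
  shows "ereal (dist (s 0) (s u) + dist (s u) (s m) + dist (s m) (s v) + dist (s v) (s 1))
           \<le> curve_length s"
  using chain_length_le_curve_length[of "[0, u, m, v, 1]" s] assms
  by (simp add: add.assoc)

section \<open>Overlap of the two halves of a curve along connected arms\<close>

lemma infdist_compact_attained:
  assumes "compact K" "K \<noteq> {}"
  shows "\<exists>y\<in>K. infdist z K = dist z y"
proof -
  have "continuous_on K (dist z)" by (intro continuous_intros)
  then obtain y where y: "y \<in> K" "\<forall>w\<in>K. dist z y \<le> dist z w"
    using continuous_attains_inf[OF assms] by blast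
  then have "dist z y \<le> infdist z K"
    using assms unfolding infdist_def by (auto intro!: cINF_greatest)
  with y(1) show ?thesis using infdist_le antisym by metis
qed

lemma infdist_compact_image_attained:
  assumes "continuous_on {a..b} s" "a \<le> (b::real)"
  shows "\<exists>t\<in>{a..b}. infdist z (s ` {a..b}) = dist z (s t)"
proof -
  have "compact (s ` {a..b})" "s ` {a..b} \<noteq> {}"
    using assms compact_continuous_image by auto
  then show ?thesis
    using infdist_compact_attained[of "s ` {a..b}" z] by blast
qed

text \<open>C plays the role of the two arms leading to the outer tips.\<close>
lemma connected_near_curve:
  fixes s :: "real \<Rightarrow> 'a::metric_space"
  assumes s: "continuous_on {0..1} s"
    and L: "curve_length s = ereal L"
    and C: "connected C" "a \<in> C" "b \<in> C"
    and near: "\<And>z. z \<in> C \<Longrightarrow> infdist z (s ` {0..1}) \<le> e"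
    and t: "ta \<in> {0..1}" "tb \<in> {0..1}" "ta \<le> m" "m \<le> tb"
      "dist a (s ta) \<le> e" "dist b (s tb) \<le> e"
  obtains w where "w \<in> C" "dist w (s m) \<le> 2 * e + (L - dist (s 0) (s 1)) / 2"
proof -
  have m: "0 \<le> m" "m \<le> 1" using t by auto
  define A where "A = {z. infdist z (s ` {0..m}) \<le> e}"
  define B where "B = {z. infdist z (s ` {m..1}) \<le> e}"
  have cs: "continuous_on {0..m} s" "continuous_on {m..1} s"
    using s m by (auto intro: continuous_on_subset)
  have "closed A" "closed B"
    unfolding A_def B_def by (auto intro!: closed_Collect_le continuous_intros)
  moreover have "C \<subseteq> A \<union> B"
  proof
    fix z assume "z \<in> C"
    obtain t where t: "t \<in> {0..1}" "infdist z (s ` {0..1}) = dist z (s t)"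
      using infdist_compact_image_attained[OF s, of z] by auto
    have "infdist z (s ` {0..m}) \<le> dist z (s t) \<or> infdist z (s ` {m..1}) \<le> dist z (s t)"
      using t(1) by (cases "t \<le> m") (auto intro!: infdist_le)
    then show "z \<in> A \<union> B"
      using near[OF \<open>z \<in> C\<close>] t(2) by (auto simp: A_def B_def)
  qed
  moreover have "a \<in> A" "b \<in> B"
    using t m infdist_le[of "s ta" "s ` {0..m}" a] infdist_le[of "s tb" "s ` {m..1}" b]
    by (auto simp: A_def B_def)
  \<comment> \<open>The closed sets \<open>A\<close> and \<open>B\<close> cover the connected set
    \<open>C\<close> and both meet it, so they have a common point in \<open>C\<close>.\<close>
  ultimately obtain w where w: "w \<in> C" "w \<in> A" "w \<in> B"
    using C unfolding connected_closed by blast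
  obtain u where u: "u \<in> {0..m}" "dist w (s u) \<le> e"
    using infdist_compact_image_attained[OF cs(1) m(1), of w] w(2) unfolding A_def by force
  obtain v where v: "v \<in> {m..1}" "dist w (s v) \<le> e"
    using infdist_compact_image_attained[OF cs(2) m(2), of w] w(3) unfolding B_def by force
  have "dist (s 0) (s u) + dist (s u) (s m) + dist (s m) (s v) + dist (s v) (s 1) \<le> L"
    using four_chords_le_curve_length[of u m v s] u v L by auto
  moreover have "dist (s 0) (s 1) \<le> dist (s 0) (s u) + dist (s u) (s v) + dist (s v) (s 1)"
    by (metis add.commute add_left_mono dist_triangle order_trans)
  moreover have "dist (s u) (s v) \<le> 2 * e"
    using u v dist_triangle3[of "s u" "s v" w] by simp
  moreover have "dist w (s m) \<le> e + dist (s u) (s m)" "dist w (s m) \<le> e + dist (s m) (s v)"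
    using u v dist_triangle[of w "s m" "s u"] dist_triangle[of w "s m" "s v"]
    by (auto simp: dist_commute)
  ultimately have "dist w (s m) \<le> 2 * e + (L - dist (s 0) (s 1)) / 2"
    by (simp add: field_simps)
  with w(1) show ?thesis by (rule that)
qed

lemma connected_arms: "connected (arm i \<union> arm j)"
  unfolding arm_def
  by (intro connected_Un) (auto intro: convex_connected)

lemma axis_in_arm: "axis i 1 \<in> arm i"
  by (simp add: arm_def)

lemma arm_subset_tripod: "arm i \<subseteq> tripod"
  using exhaust_3[of i] by (auto simp: tripod_def)

lemma compact_tripod: "compact tripod"
  unfolding tripod_def arm_def by (intro compact_Un compact_segment)

text \<open>Selects the tip with the middle parameter; the separation condition is symmetric in the
  tips, so any tip may take this role.\<close>

lemma three_sorted_enum: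
  fixes t :: "3 \<Rightarrow> real"
  obtains i j k where "i \<noteq> j" "j \<noteq> k" "i \<noteq> k" "t i \<le> t j" "t j \<le> t k"
proof -
  have d: "(1::3) \<noteq> 2" "(2::3) \<noteq> 3" "(1::3) \<noteq> 3" by auto
  show ?thesis
    using that[of 1 2 3] that[of 1 3 2] that[of 2 1 3] that[of 2 3 1] that[of 3 1 2] that[of 3 2 1] d
    by (metis linear)
qed

text \<open>The middle tip is within \<open>e\<close> of its curve point, and some point of the
  other two arms is within \<open>2 * e\<close> plus half the excess of it.\<close>

lemma antenna_excess_bound:
  assumes ant: "has_antenna c X x r"
    and s: "continuous_on {0..1} s"
    and L: "curve_length s = ereal L"
    and near: "\<And>z. z \<in> X \<inter> ball x r \<Longrightarrow> infdist z (s ` {0..1}) \<le> e"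
  shows "c * r \<le> 3 * (L - dist (s 0) (s 1) + e)"
proof -
  obtain h h' where h: "homeomorphism tripod (h ` tripod) h h'"
    and hX: "h ` tripod \<subseteq> X \<inter> ball x r"
    and sep: "\<forall>i j k :: 3. i \<noteq> j \<and> j \<noteq> k \<and> i \<noteq> k \<longrightarrow>
          c * r \<le> infdist (h (axis i 1)) (h ` (arm j \<union> arm k))"
    using ant unfolding has_antenna_def by (elim exE conjE) (rule that)
  have near_h: "infdist (h y) (s ` {0..1}) \<le> e" if "y \<in> arm i" for y i
    using that near hX arm_subset_tripod[of i] by blast
  have "\<exists>t. t \<in> {0..1} \<and> dist (h (axis i 1)) (s t) \<le> e" for i :: 3
    using infdist_compact_image_attained[OF s, of "h (axis i 1)"] near_h[OF axis_in_arm[of i]]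
    by (metis zero_le_one)
  then obtain t where t: "\<And>i. t i \<in> {0..1}" "\<And>i. dist (h (axis i 1)) (s (t i)) \<le> e"
    by metis
  obtain i j k where ijk: "i \<noteq> j" "j \<noteq> k" "i \<noteq> k" "t i \<le> t j" "t j \<le> t k"
    by (rule three_sorted_enum)
  let ?C = "h ` (arm i \<union> arm k)"
  have "connected ?C"
    using h arm_subset_tripod
    by (intro connected_continuous_image connected_arms)
       (auto simp: homeomorphism_def intro: continuous_on_subset)
  then obtain w where w: "w \<in> ?C"
      "dist w (s (t j)) \<le> 2 * e + (L - dist (s 0) (s 1)) / 2"
    using connected_near_curve[OF s L, of ?C "h (axis i 1)" "h (axis k 1)" e "t i" "t k" "t j"]
      near_h t ijk axis_in_arm by blast
  have "c * r \<le> infdist (h (axis j 1)) ?C"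
    using sep[rule_format, of j i k] ijk by auto
  also have "\<dots> \<le> dist (h (axis j 1)) w"
    by (rule infdist_le) fact
  also have "\<dots> \<le> dist (h (axis j 1)) (s (t j)) + dist w (s (t j))"
    by (rule dist_triangle2)
  finally have "c * r \<le> 3 * e + (L - dist (s 0) (s 1)) / 2"
    using t(2)[of j] w(2) by simp
  \<comment> \<open>The excess is nonnegative, so its factor 1/2 may be raised to 3, matching the
    numerator in \<open>beta'\<close>.\<close>
  moreover have "dist (s 0) (s 1) \<le> L"
    using four_chords_le_curve_length[of 0 0 0 s] L by simp
  ultimately show ?thesis by (simp add: field_simps)
qed

text \<open>As the endpoints are less than \<open>2 * r\<close> apart, every quotient is at least
  \<open>c / 6\<close>. The infimum inherits only a weak inequality; strictness comes from
  \<open>c / 7 < c / 6\<close>.\<close>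

lemma antenna_imp_beta'_gt:
  assumes ant: "has_antenna c X x r" "0 < c" "0 < r" "x \<in> X"
  shows "ereal (c / 7) < beta' X x r"
proof -
  have "ereal (c / 6) \<le>
      (curve_length s - ereal (dist (s 0) (s 1))
           + (SUP z\<in>X \<inter> ball x r. ereal (infdist z (path_image s))))
        / ereal (dist (s 0) (s 1))"
    if s: "path s" "path_image s \<subseteq> ball x r" "s 0 \<noteq> s 1" for s
  proof -
    let ?D = "dist (s 0) (s 1)"
    let ?E = "SUP z\<in>X \<inter> ball x r. ereal (infdist z (path_image s))"
    have D: "0 < ?D" using s by simp
    have s01: "s 0 \<in> ball x r" "s 1 \<in> ball x r"
      using s(2) pathstart_in_path_image[of s] pathfinish_in_path_image[of s]
      by (auto simp: pathstart_def pathfinish_def)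
    then have D2: "?D < 2 * r"
      using dist_triangle3[of "s 0" "s 1" x] by simp
    \<comment> \<open>The supremum is a real number: it is at most \<open>2 * r\<close>, and it
      ranges over a set containing \<open>x\<close>, so it is not minus infinity.\<close>
    have "infdist z (path_image s) \<le> 2 * r" if "z \<in> ball x r" for z
      using that s01 infdist_le[of "s 0" "path_image s" z] dist_triangle3[of z "s 0" x]
      by (auto simp: path_image_def)
    then have "?E \<le> ereal (2 * r)"
      by (auto intro!: SUP_least)
    moreover have "ereal (infdist x (path_image s)) \<le> ?E"
      using ant by (intro SUP_upper) auto
    ultimately obtain e where e: "?E = ereal e"
      by (cases ?E) auto
    show ?thesis
    proof (cases "curve_length s")
      case (real L)
      have "infdist z (s ` {0..1}) \<le> e" if "z \<in> X \<inter> ball x r" for z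
        using SUP_upper[OF that, of "\<lambda>z. ereal (infdist z (path_image s))"] e
        by (simp add: path_image_def)
      then have "c * r \<le> 3 * (L - ?D + e)"
        using antenna_excess_bound[OF ant(1) _ real] s(1) by (auto simp: path_def)
      moreover have "c * ?D \<le> c * (2 * r)"
        using D2 ant by (intro mult_left_mono) auto
      ultimately have "c / 6 \<le> (L - ?D + e) / ?D"
        using D by (simp add: field_simps)
      then show ?thesis
        using D by (simp add: real e)
    next
      case PInf
      then show ?thesis using D e by simp
    next
      case MInf
      then show ?thesis
        using four_chords_le_curve_length[of 0 0 0 s] by simp
    qed
  qed
  then have "ereal (c / 6) \<le> beta' X x r"
    unfolding beta'_def by (intro INF_greatest) auto
  moreover have "ereal (c / 7) < ereal (c / 6)"
    using ant by simp
  ultimately show ?thesis by (rule order.strict_trans2[rotated])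
qed

section \<open>Quasisymmetric images\<close>

lemma increasing_homeomorphism_small:
  assumes "homeomorphism {0<..} {0<..} \<eta> \<eta>'" "strict_mono_on {0<..} (\<eta> :: real \<Rightarrow> real)" "0 < e"
  obtains d where "0 < d" "\<And>t. 0 < t \<Longrightarrow> t < d \<Longrightarrow> \<eta> t < e"
proof
  show "0 < \<eta>' e" using assms by (auto simp: homeomorphism_def)
  show "\<eta> t < e" if "0 < t" "t < \<eta>' e" for t
  proof -
    have "\<eta> t < \<eta> (\<eta>' e)"
      using that \<open>0 < \<eta>' e\<close> by (intro strict_mono_onD[OF assms(2)]) auto
    also have "\<eta> (\<eta>' e) = e"
      using assms(1,3) by (simp add: homeomorphism_def)
    finally show ?thesis .
  qed
qed

text \<open>Against a fixed \<open>z \<noteq> y\<close>, the image distance of \<open>x\<close> and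
  \<open>y\<close> is controlled by \<open>\<eta>\<close> near 0, where \<open>\<eta>\<close> is
  arbitrarily small.\<close>

lemma quasisymmetric_imp_continuous:
  assumes "quasisymmetric_on S f"
  shows "continuous_on S f"
  unfolding continuous_on_iff
proof (intro ballI allI impI)
  fix y and e :: real
  assume y: "y \<in> S" and e: "0 < e"
  obtain \<eta> \<eta>' where inj: "inj_on f S" and \<eta>: "homeomorphism {0<..} {0<..} \<eta> \<eta>'"
      "strict_mono_on {0<..} (\<eta> :: real \<Rightarrow> real)"
    and qs: "\<forall>x\<in>S. \<forall>y\<in>S. \<forall>z\<in>S. x \<noteq> y \<and> y \<noteq> z \<and> x \<noteq> z \<longrightarrow>
       dist (f x) (f y) / dist (f z) (f y) \<le> \<eta> (dist x y / dist z y)"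
    using assms unfolding quasisymmetric_on_def by (elim exE conjE) (rule that)
  show "\<exists>d>0. \<forall>x\<in>S. dist x y < d \<longrightarrow> dist (f x) (f y) < e"
  proof (cases "\<exists>z\<in>S. z \<noteq> y")
    case True
    then obtain z where z: "z \<in> S" "z \<noteq> y" by blast
    let ?D = "dist z y" and ?F = "dist (f z) (f y)"
    have D: "0 < ?D" using z by simp
    have F: "0 < ?F" using z y inj by (auto dest: inj_onD)
    obtain d where d: "0 < d" "\<And>t. 0 < t \<Longrightarrow> t < d \<Longrightarrow> \<eta> t < e / ?F"
      using increasing_homeomorphism_small[OF \<eta>, of "e / ?F"] e F by auto
    \<comment> \<open>The bound by \<open>?D\<close> forces \<open>x \<noteq> z\<close>, since
      quasisymmetry speaks of three distinct points.\<close>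
    have "dist (f x) (f y) < e" if x: "x \<in> S" "dist x y < min ?D (d * ?D)" for x
    proof (cases "x = y")
      case False
      have "x \<noteq> z" using x by auto
      then have "dist (f x) (f y) / ?F \<le> \<eta> (dist x y / ?D)"
        using qs x y z False by auto
      also have "\<dots> < e / ?F"
        using x False D by (intro d(2)) (auto simp: field_simps)
      finally show ?thesis using F by (simp add: divide_less_cancel)
    qed (use e in simp)
    moreover have "0 < min ?D (d * ?D)" using d D by simp
    ultimately show ?thesis by blast
  next
    case False
    then have "\<forall>x\<in>S. x = y" by blast
    then show ?thesis using e zero_less_one by auto
  qed
qed

section \<open>Transfer of antennas to the image\<close>

lemma diameter_le_dist:
  assumes "S \<noteq> {} \<or> 0 \<le> d" "\<And>x y. x \<in> S \<Longrightarrow> y \<in> S \<Longrightarrow> dist x y \<le> d"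
  shows "diameter S \<le> d"
  using assms by (auto simp: diameter_def intro!: cSUP_least)

lemma exists_dist_ge_if_less_half_diameter:
  assumes "bounded T" "0 < r" "r < diameter T / 2"
  obtains w where "w \<in> T" "r \<le> dist w (y :: 'a::metric_space)"
proof -
  have "\<exists>w\<in>T. r \<le> dist w y"
  proof (rule ccontr)
    assume "\<not> ?thesis"
    then have *: "\<And>w. w \<in> T \<Longrightarrow> dist w y < r" by force
    have "diameter T \<le> 2 * r"
    proof (rule diameter_le_dist)
      show "T \<noteq> {} \<or> 0 \<le> 2 * r" using assms by simp
      show "dist a b \<le> 2 * r" if "a \<in> T" "b \<in> T" for a b
        using that dist_triangle2[of a b y] *[of a] *[of b] by simp
    qed
    with assms show False by simp
  qed
  then show ?thesis using that by blast
qed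

text \<open>For a tip \<open>p\<close> and a point \<open>w\<close> of the opposite arms, one of
  \<open>x\<close>, \<open>z\<close> has its image at least \<open>\<rho> / 2\<close> from
  \<open>f p\<close>. Comparing it with \<open>w\<close> as seen from \<open>p\<close> involves a
  ratio of at most \<open>4 / c\<close>, so \<open>f w\<close> cannot be much closer to
  \<open>f p\<close>.\<close>

lemma antenna_quasisymmetric_image:
  fixes f :: "'a::metric_space \<Rightarrow> 'b::metric_space"
  assumes ant: "has_antenna c S x r" and c: "0 < c" and r: "0 < r"
    and S: "x \<in> S" "continuous_on S f" "inj_on f S"
    and mono: "strict_mono_on {0<..} \<eta>"
    and qs: "\<forall>x\<in>S. \<forall>y\<in>S. \<forall>z\<in>S. x \<noteq> y \<and> y \<noteq> z \<and> x \<noteq> z \<longrightarrow>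
       dist (f x) (f y) / dist (f z) (f y) \<le> \<eta> (dist x y / dist z y)"
    and img: "\<And>w. w \<in> S \<Longrightarrow> dist x w < r \<Longrightarrow> dist (f x) (f w) < \<rho>"
    and z: "z \<in> S" "r \<le> dist x z" "dist x z \<le> 3 * r" "\<rho> \<le> dist (f x) (f z)"
    and c': "0 < c'" "c' \<le> 1 / 2" "c' * (2 * \<eta> (4 / c)) \<le> 1" and \<rho>: "0 < \<rho>"
  shows "has_antenna c' (f ` S) (f x) \<rho>"
proof -
  obtain h h' where h: "homeomorphism tripod (h ` tripod) h h'"
    and hS: "h ` tripod \<subseteq> S \<inter> ball x r"
    and sep: "\<forall>i j k :: 3. i \<noteq> j \<and> j \<noteq> k \<and> i \<noteq> k \<longrightarrow>
          c * r \<le> infdist (h (axis i 1)) (h ` (arm j \<union> arm k))"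
    using ant unfolding has_antenna_def by (elim exE conjE) (rule that)
  have "continuous_on tripod (f \<circ> h)"
    using h hS S by (intro continuous_on_compose) (auto simp: homeomorphism_def intro: continuous_on_subset)
  moreover have "inj_on h tripod"
    using h by (auto simp: homeomorphism_def intro: inj_on_inverseI)
  then have "inj_on (f \<circ> h) tripod"
    using hS S by (intro comp_inj_on) (auto intro: inj_on_subset)
  ultimately obtain g where g: "homeomorphism tripod ((f \<circ> h) ` tripod) (f \<circ> h) g"
    using homeomorphism_compact[OF compact_tripod, of "f \<circ> h"] by metis
  have dist_ge: "c' * \<rho> \<le> dist (f p) (f w)"
    if p: "p \<in> S" "dist x p < r" and w: "w \<in> S" "dist x w < r" and pw: "c * r \<le> dist p w" for p w
  proof -
    have "0 < c * r" using c r by simp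
    then have "p \<noteq> w" using pw by auto
    then have F: "0 < dist (f w) (f p)" using p w S by (auto dest: inj_onD)
    \<comment> \<open>The reference point \<open>q\<close> will be \<open>z\<close> or
      \<open>x\<close>.\<close>
    have far: "c' * \<rho> \<le> dist (f p) (f w)"
      if q: "q \<in> S" "q \<noteq> w" "\<rho> / 2 \<le> dist (f q) (f p)" "dist q p \<le> 4 * r" for q
    proof -
      have "q \<noteq> p" using q \<rho> by auto
      have "dist q p / dist w p \<le> 4 * r / (c * r)"
        using q pw \<open>0 < c * r\<close> r by (intro frac_le) (auto simp: dist_commute)
      then have le: "dist q p / dist w p \<le> 4 / c" using r by simp
      have "dist (f q) (f p) / dist (f w) (f p) \<le> \<eta> (dist q p / dist w p)"
        using qs q p w \<open>q \<noteq> p\<close> \<open>p \<noteq> w\<close> by auto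
      also have "\<dots> \<le> \<eta> (4 / c)"
        using mono le c \<open>q \<noteq> p\<close> \<open>p \<noteq> w\<close>
        by (intro strict_mono_on_leD[OF mono]) auto
      finally have "\<rho> \<le> 2 * \<eta> (4 / c) * dist (f w) (f p)"
        using q(3) F by (simp add: field_simps)
      then have "c' * \<rho> \<le> c' * (2 * \<eta> (4 / c) * dist (f w) (f p))"
        using c' by (intro mult_left_mono) auto
      also have "\<dots> = c' * (2 * \<eta> (4 / c)) * dist (f w) (f p)" by simp
      also have "\<dots> \<le> 1 * dist (f w) (f p)"
        using c'(3) by (intro mult_right_mono) auto
      finally show ?thesis by (simp add: dist_commute)
    qed
    have "\<rho> / 2 \<le> dist (f z) (f p) \<or> \<rho> / 2 \<le> dist (f x) (f p)"
      using z(4) dist_triangle2[of "f x" "f z" "f p"] by linarith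
    then show ?thesis
    proof
      assume "\<rho> / 2 \<le> dist (f z) (f p)"
      moreover have "dist z p \<le> 4 * r"
        using z p dist_triangle3[of z p x] by simp
      moreover have "z \<noteq> w" using z w by auto
      ultimately show ?thesis using far[of z] z by blast
    next
      assume *: "\<rho> / 2 \<le> dist (f x) (f p)"
      show ?thesis
      \<comment> \<open>If \<open>x = w\<close>, the three points are not distinct, but
        \<open>f w\<close> itself is then \<open>\<rho> / 2\<close> away from \<open>f p\<close> and
        \<open>c' \<le> 1 / 2\<close> suffices.\<close>
      proof (cases "x = w")
        case True
        have "c' * \<rho> \<le> 1 / 2 * \<rho>" using c' \<rho> by (intro mult_right_mono) auto
        with * True show ?thesis by (simp add: dist_commute)
      next
        case False
        then show ?thesis using far[of x] * S p r by auto
      qed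
    qed
  qed
  have "c' * \<rho> \<le> infdist ((f \<circ> h) (axis i 1)) ((f \<circ> h) ` (arm j \<union> arm k))"
    if ijk: "i \<noteq> j \<and> j \<noteq> k \<and> i \<noteq> k" for i j k :: 3
  proof -
    have ne: "arm j \<union> arm k \<noteq> {}" using axis_in_arm by blast
    have in_ball: "h y \<in> S" "dist x (h y) < r" if "y \<in> arm l" for y l
    proof -
      have "h y \<in> S \<inter> ball x r" using that hS arm_subset_tripod[of l] by blast
      then show "h y \<in> S" "dist x (h y) < r" by auto
    qed
    have "c' * \<rho> \<le> dist (f (h (axis i 1))) (f (h y))" if y: "y \<in> arm j \<union> arm k" for y
    proof (rule dist_ge)
      show "c * r \<le> dist (h (axis i 1)) (h y)"
        using order_trans[OF sep[rule_format, OF ijk] infdist_le[OF imageI[OF y]]] .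
    qed (use y in_ball axis_in_arm in blast)+
    then show ?thesis
      using ne unfolding infdist_def by (auto intro!: cINF_greatest)
  qed
  moreover have "(f \<circ> h) ` tripod \<subseteq> f ` S \<inter> ball (f x) \<rho>"
    using hS img by fastforce
  ultimately show ?thesis
    unfolding has_antenna_def using g
    by (intro exI[of _ "f \<circ> h"] exI[of _ g] conjI allI impI) simp_all
qed

lemma antenna_like_quasisymmetric_image:
  fixes f :: "'a::metric_space \<Rightarrow> 'b::metric_space"
  assumes "antenna_like S" and q: "quasisymmetric_on S f"
  shows "antenna_like (f ` S)"
proof -
  obtain c where c: "0 < c" and comp: "compact S" and conn: "connected S"
    and ant: "\<And>x r. x \<in> S \<Longrightarrow> 0 < r \<Longrightarrow> r < diameter S / 2 \<Longrightarrow> has_antenna c S x r"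
    using assms(1) unfolding antenna_like_def antenna_like_with_def by blast
  obtain \<eta> \<eta>' where inj: "inj_on f S" and \<eta>: "homeomorphism {0<..} {0<..} \<eta> \<eta>'"
      "strict_mono_on {0<..} (\<eta> :: real \<Rightarrow> real)"
    and qs: "\<forall>x\<in>S. \<forall>y\<in>S. \<forall>z\<in>S. x \<noteq> y \<and> y \<noteq> z \<and> x \<noteq> z \<longrightarrow>
       dist (f x) (f y) / dist (f z) (f y) \<le> \<eta> (dist x y / dist z y)"
    using q unfolding quasisymmetric_on_def by (elim exE conjE) (rule that)
  have cont: "continuous_on S f"
    using q by (rule quasisymmetric_imp_continuous)
  have cT: "compact (f ` S)"
    using comp cont by (rule compact_continuous_image[rotated])
  have \<eta>pos: "0 < \<eta> (4 / c)"
    using \<eta>(1) c by (auto simp: homeomorphism_def)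
  \<comment> \<open>The value 1/2 serves the degenerate case where a point of the arms is the
    centre, the other value the comparison through \<open>\<eta>\<close>.\<close>
  define c' where "c' = min (1 / 2) (1 / (2 * \<eta> (4 / c)))"
  have c': "0 < c'" "c' \<le> 1 / 2" using \<eta>pos by (auto simp: c'_def)
  have "c' \<le> 1 / (2 * \<eta> (4 / c))" by (simp add: c'_def)
  then have c'3: "c' * (2 * \<eta> (4 / c)) \<le> 1" using \<eta>pos by (simp add: field_simps)
  have "has_antenna c' (f ` S) (f x) \<rho>"
    if x: "x \<in> S" and \<rho>: "0 < \<rho>" "\<rho> < diameter (f ` S) / 2" for x \<rho>
  proof -
    \<comment> \<open>\<open>M\<close> collects the points mapped outside the open image ball; it is
      compact, and the bound on \<open>\<rho>\<close> makes it nonempty.\<close>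
    define M where "M = {w \<in> S. \<rho> \<le> dist (f w) (f x)}"
    obtain w0 where "w0 \<in> f ` S" "\<rho> \<le> dist w0 (f x)"
      using exists_dist_ge_if_less_half_diameter[OF compact_imp_bounded[OF cT] \<rho>] by blast
    then have "M \<noteq> {}" by (auto simp: M_def)
    moreover have "closed (S \<inter> (\<lambda>w. dist (f w) (f x)) -` {\<rho>..})"
      using cont comp
      by (intro continuous_closed_preimage continuous_intros compact_imp_closed) auto
    then have "compact (S \<inter> (S \<inter> (\<lambda>w. dist (f w) (f x)) -` {\<rho>..}))"
      by (rule compact_Int_closed[OF comp])
    moreover have "S \<inter> (S \<inter> (\<lambda>w. dist (f w) (f x)) -` {\<rho>..}) = M"
      by (auto simp: M_def)
    ultimately obtain z where z: "z \<in> M" "infdist x M = dist x z"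
      using infdist_compact_attained[of M x] by blast
    \<comment> \<open>Since \<open>dist x z \<le> diameter S\<close>, a third of it lies strictly
      below half the diameter; points closer to \<open>x\<close> than \<open>z\<close> are not in
      \<open>M\<close>.\<close>
    let ?r = "dist x z / 3"
    have "z \<noteq> x" using z \<rho> by (auto simp: M_def)
    then have r: "0 < ?r" by simp
    have "dist x z \<le> diameter S"
      using diameter_bounded_bound[OF compact_imp_bounded[OF comp]] x z by (auto simp: M_def)
    then have "?r < diameter S / 2" using r by linarith
    then have "has_antenna c S x ?r" using ant x r by blast
    moreover have "dist (f x) (f w) < \<rho>" if "w \<in> S" "dist x w < ?r" for w
    proof (rule ccontr)
      assume "\<not> ?thesis"
      then have "w \<in> M" using that by (simp add: M_def dist_commute)
      then have "dist x z \<le> dist x w" using infdist_le z by metis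
      with that r show False by simp
    qed
    ultimately show ?thesis
      using z x r \<rho> c' c'3 c
      by (intro antenna_quasisymmetric_image[OF _ c r x cont inj \<eta>(2) qs, where z = z])
         (auto simp: M_def dist_commute)
  qed
  then have "antenna_like_with c' (f ` S)"
    using cT connected_continuous_image[OF cont conn] by (auto simp: antenna_like_with_def)
  then show ?thesis using c' by (auto simp: antenna_like_def)
qed

section \<open>Isometric embedding into the bounded sequences\<close>

text \<open>Images of covers are covers with no larger diameters. The hypothesis is global because
  covering sets may leave \<open>A\<close>.\<close>

lemma hausdorff_dim_nonexpansive_image:
  fixes g :: "'a::metric_space \<Rightarrow> 'b::metric_space"
  assumes g: "\<And>x y. dist (g x) (g y) \<le> dist x y"
  shows "hausdorff_dim (g ` A) \<le> hausdorff_dim A"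
proof -
  have diam: "bounded (g ` U)" "diameter (g ` U) \<le> diameter U" if U: "bounded U" for U
  proof -
    obtain x e where "\<forall>y\<in>U. dist x y \<le> e" using U by (auto simp: bounded_def)
    then show "bounded (g ` U)"
      unfolding bounded_def
      by (intro exI[of _ "g x"] exI[of _ e]) (auto intro: order_trans[OF g])
    show "diameter (g ` U) \<le> diameter U"
    proof (rule diameter_le_dist)
      show "g ` U \<noteq> {} \<or> 0 \<le> diameter U" using diameter_ge_0[OF U] by simp
    qed (auto intro!: order_trans[OF g] diameter_bounded_bound[OF U])
  qed
  have "hausdorff_premeasure \<delta> s (g ` A) \<le> hausdorff_premeasure \<delta> s A" if "0 < s" for \<delta> s
    unfolding hausdorff_premeasure_def
  proof (rule INF_mono)
    fix U :: "nat \<Rightarrow> 'a set"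
    assume U: "U \<in> {U. A \<subseteq> (\<Union>i. U i) \<and> (\<forall>i. bounded (U i) \<and> diameter (U i) \<le> \<delta>)}"
    have "(\<lambda>i. g ` U i) \<in> {U. g ` A \<subseteq> (\<Union>i. U i) \<and> (\<forall>i. bounded (U i) \<and> diameter (U i) \<le> \<delta>)}"
      using U diam order_trans[OF diam(2)] by (simp add: image_subset_iff subset_iff) blast
    moreover have "(\<Sum>i. ennreal (diameter (g ` U i) powr s)) \<le> (\<Sum>i. ennreal (diameter (U i) powr s))"
      using U diam that
      by (intro suminf_le ennreal_leI powr_mono2) (auto intro: diameter_ge_0)
    ultimately show "\<exists>V\<in>{U. g ` A \<subseteq> (\<Union>i. U i) \<and> (\<forall>i. bounded (U i) \<and> diameter (U i) \<le> \<delta>)}.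
        (\<Sum>i. ennreal (diameter (V i) powr s)) \<le> (\<Sum>i. ennreal (diameter (U i) powr s))"
      by - (rule bexI[of _ "\<lambda>i. g ` U i"])
  qed
  then have "hausdorff_measure s (g ` A) \<le> hausdorff_measure s A" if "0 < s" for s
    unfolding hausdorff_measure_def using that by (intro SUP_mono) auto
  then have "hausdorff_measure s (g ` A) = 0" if "0 < s" "hausdorff_measure s A = 0" for s
    using that by (metis le_zero_eq)
  then show ?thesis
    unfolding hausdorff_dim_def by (intro Inf_superset_mono image_mono) auto
qed

text \<open>The union of finite nets of mesh \<open>inverse (Suc n)\<close> is countable and
  dense.\<close>

lemma compact_imp_separable:
  fixes T :: "'a::metric_space set"
  assumes "compact T"
  obtains Q where "countable Q" "Q \<subseteq> T" "T \<subseteq> closure Q"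
proof -
  have "\<exists>K. finite K \<and> K \<subseteq> T \<and> T \<subseteq> (\<Union>x\<in>K. ball x (inverse (Suc n)))" for n
    using seq_compact_imp_totally_bounded[OF compact_imp_seq_compact[OF assms]] by simp
  then obtain K where K: "\<And>n. finite (K n)" "\<And>n. K n \<subseteq> T"
      "\<And>n. T \<subseteq> (\<Union>x\<in>K n. ball x (inverse (Suc n)))"
    by metis
  show ?thesis
  proof
    show "countable (\<Union>n. K n)" using K(1) by (auto intro: countable_finite)
    show "(\<Union>n. K n) \<subseteq> T" using K(2) by blast
    show "T \<subseteq> closure (\<Union>n. K n)"
    proof
      fix x assume x: "x \<in> T"
      show "x \<in> closure (\<Union>n. K n)"
        unfolding closure_approachable
      proof (intro allI impI)
        fix e :: real assume "0 < e"
        then obtain n where "inverse (Suc n) < e" using reals_Archimedean by blast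
        moreover obtain y where "y \<in> K n" "dist y x < inverse (Suc n)"
          using K(3)[of n] x by auto
        ultimately show "\<exists>y\<in>\<Union>n. K n. dist y x < e"
          by (intro bexI[of _ y]) auto
      qed
    qed
  qed
qed

lemma linfty_embedding:
  fixes T :: "'a::metric_space set"
  assumes "compact T"
  obtains g :: "'a \<Rightarrow> linfty" where "\<And>x y. dist (g x) (g y) \<le> dist x y"
    "\<And>x y. x \<in> T \<Longrightarrow> y \<in> T \<Longrightarrow> dist (g x) (g y) = dist x y"
proof (cases "T = {}")
  case True
  then show ?thesis by (intro that[of "\<lambda>_. 0"]) auto
next
  case False
  obtain Q where Q: "countable Q" "Q \<subseteq> T" "T \<subseteq> closure Q"
    using compact_imp_separable[OF assms] .
  have "Q \<noteq> {}" using Q False by auto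
  then obtain q :: "nat \<Rightarrow> 'a" where q: "range q = Q"
    using Q(1) by (metis uncountable_def)
  \<comment> \<open>Subtracting \<open>dist (q 0) (q n)\<close> keeps the sequence bounded for every
    \<open>x\<close>, also outside \<open>T\<close>, so \<open>g\<close> is nonexpansive on the
    whole space.\<close>
  define g :: "'a \<Rightarrow> linfty" where
    "g x = Bcontfun (\<lambda>n. dist x (q n) - dist (q 0) (q n))" for x
  have bc: "(\<lambda>n. dist x (q n) - dist (q 0) (q n)) \<in> bcontfun" for x
  proof (rule bcontfun_normI)
    show "norm (dist x (q n) - dist (q 0) (q n)) \<le> dist x (q 0)" for n
      using abs_dist_diff_le[of x "q n" "q 0"] by (simp add: dist_commute)
  qed simp
  have g: "apply_bcontfun (g x) n = dist x (q n) - dist (q 0) (q n)" for x n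
    unfolding g_def by (simp add: Bcontfun_inverse[OF bc])
  have le: "dist (g x) (g y) \<le> dist x y" for x y
  proof (rule dist_bound)
    show "dist (g x n) (g y n) \<le> dist x y" for n
      using abs_dist_diff_le[of x "q n" y] by (simp add: g dist_real_def dist_commute)
  qed
  have "dist x y \<le> dist (g x) (g y)" if "x \<in> T" "y \<in> T" for x y
  proof (rule field_le_epsilon)
    fix e :: real assume "0 < e"
    \<comment> \<open>A coordinate with \<open>q n\<close> close to \<open>x\<close> recovers
      \<open>dist x y\<close> up to twice that closeness.\<close>
    then have "\<exists>y\<in>range q. dist y x < e / 2"
      using that(1) Q(3) unfolding q closure_approachable subset_iff
      by (metis half_gt_zero)
    then obtain n where n: "dist (q n) x < e / 2" by blast
    have "dist x y \<le> dist y (q n) - dist x (q n) + 2 * dist (q n) x"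
      using dist_triangle2[of x y "q n"] by (simp add: dist_commute)
    also have "dist y (q n) - dist x (q n) \<le> dist (g x n) (g y n)"
      by (simp add: g dist_real_def)
    also have "\<dots> \<le> dist (g x) (g y)" by (rule dist_bounded)
    finally show "dist x y \<le> dist (g x) (g y) + e" using n by simp
  qed
  with le show ?thesis by (intro that[of g]) (auto intro: antisym)
qed

text \<open>With \<open>\<eta>\<close> the identity, this lets the result on quasisymmetric images
  also carry antennas through the embedding.\<close>

lemma isometric_imp_quasisymmetric:
  assumes "\<And>x y. x \<in> S \<Longrightarrow> y \<in> S \<Longrightarrow> dist (g x) (g y) = dist x y"
  shows "quasisymmetric_on S g"
proof -
  have "inj_on g S" by (intro inj_onI) (metis assms dist_eq_0_iff)
  moreover have "homeomorphism {0<..} {0<..} (\<lambda>t::real. t) (\<lambda>t. t)"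
    by (simp add: homeomorphism_ident)
  moreover have "strict_mono_on {0<..} (\<lambda>t::real. t)" by (simp add: strict_mono_on_def)
  ultimately show ?thesis
    unfolding quasisymmetric_on_def using assms
    by (intro conjI exI[of _ "\<lambda>t. t"]) auto
qed

section \<open>Dimension bounds and both claims\<close>

theorem theorem6:
  fixes c0 :: real
  assumes c0_pos: "0 < c0"
    and c0_prop: "\<And>(Z :: linfty set) (\<beta> :: real) (r0 :: real).
      compact Z \<Longrightarrow> connected Z \<Longrightarrow> Z \<noteq> {} \<Longrightarrow> 0 < \<beta> \<Longrightarrow> 0 < r0 \<Longrightarrow>
      (\<And>x r. x \<in> Z \<Longrightarrow> 0 < r \<Longrightarrow> r < r0 \<Longrightarrow> ereal \<beta> < beta' Z x r) \<Longrightarrow>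
      ereal (1 + c0 * \<beta>\<^sup>2) \<le> hausdorff_dim Z"
  shows "(\<forall>X :: linfty set. compact X \<and> connected X \<longrightarrow>
            (\<forall>c x r. 0 < c \<and> x \<in> X \<and> 0 < r \<and> has_antenna c X x r \<longrightarrow>
               ereal (c / 7) < beta' X x r) \<and>
            (\<forall>c. 0 < c \<and> antenna_like_with c X \<and> 0 < diameter X \<longrightarrow>
               ereal (1 + c0 / 49 * c\<^sup>2) \<le> hausdorff_dim X)) \<and>
         (\<forall>(S :: 'a::metric_space set) (f :: 'a \<Rightarrow> 'b::metric_space).
            antenna_like S \<and> quasisymmetric_on S f \<longrightarrow>
            antenna_like (f ` S) \<and> (0 < diameter S \<longrightarrow> 1 < hausdorff_dim (f ` S)))"
proof -
  have dim: "ereal (1 + c0 / 49 * c\<^sup>2) \<le> hausdorff_dim X"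
    if "0 < c" "antenna_like_with c X" "0 < diameter X" for c and X :: "linfty set"
  proof -
    have "ereal (1 + c0 * (c / 7)\<^sup>2) \<le> hausdorff_dim X"
    \<comment> \<open>Applied with \<open>\<beta> = c / 7\<close> and
      \<open>r0 = diameter X / 2\<close>; the square of 1/7 yields the 49.\<close>
    proof (rule c0_prop)
      show "X \<noteq> {}" using that(3) by auto
      show "0 < diameter X / 2" "0 < c / 7" using that by auto
      show "ereal (c / 7) < beta' X x r" if "x \<in> X" "0 < r" "r < diameter X / 2" for x r
        using that \<open>0 < c\<close> \<open>antenna_like_with c X\<close>
        by (intro antenna_imp_beta'_gt) (auto simp: antenna_like_with_def)
    qed (use that in \<open>auto simp: antenna_like_with_def\<close>)
    then show ?thesis by (simp add: power_divide)
  qed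
  \<comment> \<open>Positive diameter excludes one-point sets, which are antenna-like
    vacuously.\<close>
  have dim_image: "1 < hausdorff_dim (f ` S)"
    if S: "antenna_like S" "quasisymmetric_on S f" "0 < diameter S"
    for S :: "'a set" and f :: "'a \<Rightarrow> 'b"
  proof -
    have T: "antenna_like (f ` S)"
      using S antenna_like_quasisymmetric_image by blast
    then have "compact (f ` S)"
      by (auto simp: antenna_like_def antenna_like_with_def)
    then obtain g :: "'b \<Rightarrow> linfty" where g: "\<And>x y. dist (g x) (g y) \<le> dist x y"
      "\<And>x y. x \<in> f ` S \<Longrightarrow> y \<in> f ` S \<Longrightarrow> dist (g x) (g y) = dist x y"
      using linfty_embedding by blast
    \<comment> \<open>The constant \<open>c0\<close> concerns subsets of \<open>linfty\<close> only,
      so the bound is proved for the embedded copy and pulled back.\<close>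
    have "antenna_like (g ` f ` S)"
      using T isometric_imp_quasisymmetric[of "f ` S" g] g(2) antenna_like_quasisymmetric_image by blast
    then obtain c where c: "0 < c" "antenna_like_with c (g ` f ` S)"
      by (auto simp: antenna_like_def)
    have "\<not> S \<subseteq> {a}" for a
      using S(3) by (auto simp: subset_singleton_iff)
    then obtain a b where ab: "a \<in> S" "b \<in> S" "a \<noteq> b"
      by (metis insert_iff subsetI)
    then have "f a \<noteq> f b"
      using S(2) by (auto simp: quasisymmetric_on_def dest: inj_onD)
    then have "0 < dist (g (f a)) (g (f b))" using g(2) ab by simp
    also have "\<dots> \<le> diameter (g ` f ` S)"
      using c(2) ab by (intro diameter_bounded_bound) (auto simp: antenna_like_with_def compact_imp_bounded)
    finally have "ereal (1 + c0 / 49 * c\<^sup>2) \<le> hausdorff_dim (g ` f ` S)"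
      using dim c by blast
    also have "\<dots> \<le> hausdorff_dim (f ` S)"
      using g(1) by (rule hausdorff_dim_nonexpansive_image)
    finally have "ereal (1 + c0 / 49 * c\<^sup>2) \<le> hausdorff_dim (f ` S)" .
    moreover have "ereal 1 < ereal (1 + c0 / 49 * c\<^sup>2)"
      using c0_pos c by simp
    ultimately show ?thesis
      unfolding one_ereal_def by (rule order.strict_trans2[rotated])
  qed
  show ?thesis
    using dim dim_image antenna_imp_beta'_gt antenna_like_quasisymmetric_image by blast
qed

end
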